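(* Let $a_k,b_k,d_k$ ($k\ge 1$) be positive real numbers and set $A_k=\begin{pmatrix} a_k & b_k\\ d_k & 0\end{pmatrix}$. Assume that there is $\sigma>0$ with $a_k,b_k,d_k\ge\sigma$ for all $k\ge1$ and $$\sum_{k=2}^\infty\big(|a_k-a_{k-1}|+|b_k-b_{k-1}|+|d_k-d_{k-1}|\big)<\infty ,$$ so that the limits $a=\lim_k a_k$, $b=\lim_k b_k$, $d=\lim_k d_k$ exist in $(0,\infty)$. Assume moreover that at least one of the following three conditions (a), (b), (c) holds. (a) There is $k_0>0$ such that $\frac{a_k}{b_k}=\frac{a_{k+1}}{b_{k+1}}$ and $\frac{d_k}{b_k}\neq\frac{d_{k+1}}{b_{k+1}}$ for all $k\ge k_0$, and $\lim_{k\to\infty}\frac{d_k/b_k-d_{k+1}/b_{k+1}}{d_{k+1}/b_{k+1}-d_{k+2}/b_{k+2}}$ exists as an extended real number. (b) There is $k_0>0$ such that $\frac{a_k}{b_k}\ne\frac{a_{k+1}}{b_{k+1}}$ and $\frac{d_k}{b_k}=\frac{d_{k+1}}{b_{k+1}}$ for all $k\ge k_0$, and $\lim_{k\to\infty}\frac{a_k/b_k-a_{k+1}/b_{k+1}}{a_{k+1}/b_{k+1}-a_{k+2}/b_{k+2}}$ exists as an extended real number. (c) There is $k_0>0$ such that $\frac{a_k}{b_k}\ne\frac{a_{k+1}}{b_{k+1}}$ and $\frac{d_k}{b_k}\ne\frac{d_{k+1}}{b_{k+1}}$ for all $k\ge k_0$; the limit $\tau:=\lim_{k\to\infty}\frac{d_k/b_k-d_{k+1}/b_{k+1}}{a_k/b_k-a_{k+1}/b_{k+1}}$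 exists as an extended real number and $\tau\neq\frac{-a+\sqrt{a^2+4bd}}{2b}$; if $\tau$ is finite, then $\lim_{k\to\infty}\frac{a_k/b_k-a_{k+1}/b_{k+1}}{a_{k+1}/b_{k+1}-a_{k+2}/b_{k+2}}$ exists as an extended real number; if $\tau$ is infinite, then $\lim_{k\to\infty}\frac{d_k/b_k-d_{k+1}/b_{k+1}}{d_{k+1}/b_{k+1}-d_{k+2}/b_{k+2}}$ exists as an extended real number. Then for all $i,j\in\{1,2\}$ and each $m\ge1$ there exists $c(m)=c_{i,j}(m)\in(0,\infty)$ such that $$\lim_{k\to\infty}\frac{\mathbf e_iA_kA_{k-1}\cdots A_m\mathbf e_j^t}{\varrho(A_k)\varrho(A_{k-1})\cdots\varrho(A_m)}=c(m).$$ Moreover, $0<\liminf_{m\to\infty}c(m)\le\limsup_{m\to\infty}c(m)<\infty$.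
   Context: $\varrho(A)$ denotes the spectral radius of a matrix $A$. $\mathbf e_1=(1,0)$, $\mathbf e_2=(0,1)$ are row vectors and $^t$ denotes transpose, so $\mathbf e_iA\mathbf e_j^t$ is the $(i,j)$ entry of $A$. An extended real number is an element of $[-\infty,\infty]$. *)

theory Defs
  imports
    "Jordan_Normal_Form.Spectral_Radius"
    "HOL-Library.Extended_Real"
    "HOL-Library.Liminf_Limsup"
begin

definition step_mat :: "(nat \<Rightarrow> real) \<Rightarrow> (nat \<Rightarrow> real) \<Rightarrow> (nat \<Rightarrow> real) \<Rightarrow> nat \<Rightarrow> real mat" where
  "step_mat a b d k = mat_of_rows_list 2 [[a k, b k], [d k, 0]]"

text \<open>For \<open>m \<le> k\<close> this is \<open>A k * A (k - 1) * \<dots> * A m\<close>, later factors standing on the left.\<close>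

definition backward_prod :: "(nat \<Rightarrow> real mat) \<Rightarrow> nat \<Rightarrow> nat \<Rightarrow> real mat" where
  "backward_prod A m k = foldr (\<lambda>l M. A l * M) (rev [m..<Suc k]) (1\<^sub>m 2)"

definition real_spectral_radius :: "real mat \<Rightarrow> real" where
  "real_spectral_radius M = spectral_radius (map_mat complex_of_real M)"

text \<open>In an expression \<open>lim f\<close> the value is meaningful only if \<open>f\<close> converges. The next lemma
  provides this for sequences of bounded variation that are bounded away from \<open>0\<close>.\<close>

lemma bounded_variation_limit:
  fixes f :: "nat \<Rightarrow> real"
  assumes "summable (\<lambda>k. \<bar>f (k + 2) - f (k + 1)\<bar>)"
    and "0 < \<sigma>" and "\<And>k. 1 \<le> k \<Longrightarrow> \<sigma> \<le> f k"
  shows "f \<longlonglongrightarrow> lim f" and "0 < lim f"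
proof -
  have "summable (\<lambda>k. f (Suc k + 1) - f (k + 1))"
    using summable_rabs_cancel[OF assms(1)] by simp
  then have "convergent (\<lambda>n. \<Sum>k<n. f (Suc k + 1) - f (k + 1))"
    by (simp only: summable_iff_convergent)
  also have "(\<lambda>n. \<Sum>k<n. f (Suc k + 1) - f (k + 1)) = (\<lambda>n. f (n + 1) - f 1)"
    by (subst sum_lessThan_telescope[where f = "\<lambda>k. f (k + 1)"]) simp
  finally have "convergent (\<lambda>n. (f (n + 1) - f 1) + f 1)"
    by (intro convergent_add convergent_const)
  then have "convergent f"
    using convergent_Suc_iff[of f] by simp
  then show lim: "f \<longlonglongrightarrow> lim f"
    by (simp only: convergent_LIMSEQ_iff)
  have "\<sigma> \<le> lim f"
    by (rule LIMSEQ_le_const[OF lim]) (use assms(3) in blast)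
  with assms(2) show "0 < lim f" by simp
qed

end

theory Submission
  imports Defs
begin

text \<open>Write \<open>\<lambda>\<^sub>k\<close> for the Perron root of \<open>A\<^sub>k\<close> and \<open>p\<^sub>k = b\<^sub>k / \<lambda>\<^sub>k\<close>, so that \<open>(1, p\<^sub>k)\<close> is a left
  eigenvector of \<open>A\<^sub>k\<close>. If \<open>(X\<^sub>k, Y\<^sub>k)\<close> is a column of the normalised product, then
  \<open>S\<^sub>k = X\<^sub>k + p\<^sub>k Y\<^sub>k\<close> satisfies \<open>S\<^sub>k\<^sub>+\<^sub>1 = X\<^sub>k + p\<^sub>k\<^sub>+\<^sub>1 Y\<^sub>k\<close>. As \<open>X\<^sub>k\<close> and \<open>Y\<^sub>k\<close> are nonnegative, this
  gives \<open>\<bar>ln S\<^sub>k\<^sub>+\<^sub>1 - ln S\<^sub>k\<bar> \<le> \<bar>ln p\<^sub>k\<^sub>+\<^sub>1 - ln p\<^sub>k\<bar>\<close>, which is summable because the entries have bounded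
  variation. Hence \<open>S\<^sub>k\<close> tends to a positive limit, with bounds uniform in \<open>m\<close>. Eliminating \<open>Y\<^sub>k\<close>
  leaves an affine recursion for \<open>X\<^sub>k\<close> with forcing term \<open>(p\<^sub>k\<^sub>+\<^sub>1 / p\<^sub>k) S\<^sub>k\<close> and a linear
  coefficient tending to \<open>a / \<lambda> - 1\<close>, which lies in \<open>(-1, 0)\<close>; so \<open>X\<^sub>k\<close> and \<open>Y\<^sub>k\<close> converge.\<close>

section \<open>Sequences\<close>

text \<open>Once \<open>r n\<close> stays below \<open>(1 - \<theta>) * (\<epsilon> / 2)\<close>,
  the level \<open>\<epsilon> / 2\<close> is the fixed point of the majorising affine map, so the
  excess of \<open>\<bar>v n\<bar>\<close> over it decays geometrically.\<close>

lemma perturbed_contraction_tendsto_0: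
  fixes v r :: "nat \<Rightarrow> real"
  assumes \<theta>: "0 \<le> \<theta>" "\<theta> < 1" and r: "r \<longlonglongrightarrow> 0"
    and step: "\<forall>\<^sub>F n in sequentially. \<bar>v (Suc n)\<bar> \<le> \<theta> * \<bar>v n\<bar> + r n"
  shows "v \<longlonglongrightarrow> 0"
proof (rule LIMSEQ_I)
  fix \<epsilon> :: real assume \<epsilon>: "0 < \<epsilon>"
  have "0 < (1 - \<theta>) * (\<epsilon> / 2)" using \<theta> \<epsilon> by simp
  then have "\<forall>\<^sub>F n in sequentially. r n < (1 - \<theta>) * (\<epsilon> / 2)"
    by (rule order_tendstoD(2)[OF r])
  with step have "\<forall>\<^sub>F n in sequentially. \<bar>v (Suc n)\<bar> \<le> \<theta> * \<bar>v n\<bar> + (1 - \<theta>) * (\<epsilon> / 2)"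
    by eventually_elim simp
  then obtain N where N: "\<bar>v (Suc n)\<bar> \<le> \<theta> * \<bar>v n\<bar> + (1 - \<theta>) * (\<epsilon> / 2)" if "N \<le> n" for n
    unfolding eventually_sequentially by blast
  have bound: "\<bar>v (n + N)\<bar> \<le> \<theta> ^ n * \<bar>v N\<bar> + \<epsilon> / 2" for n
  proof (induction n)
    case 0
    then show ?case using \<epsilon> by simp
  next
    case (Suc n)
    have "\<bar>v (Suc (n + N))\<bar> \<le> \<theta> * \<bar>v (n + N)\<bar> + (1 - \<theta>) * (\<epsilon> / 2)"
      by (rule N) simp
    also have "\<dots> \<le> \<theta> * (\<theta> ^ n * \<bar>v N\<bar> + \<epsilon> / 2) + (1 - \<theta>) * (\<epsilon> / 2)"
      using mult_left_mono[OF Suc \<theta>(1)] by simp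
    also have "\<dots> = \<theta> ^ Suc n * \<bar>v N\<bar> + \<epsilon> / 2"
      by (simp add: field_simps)
    finally show ?case by simp
  qed
  have "(\<lambda>n. \<theta> ^ n * \<bar>v N\<bar>) \<longlonglongrightarrow> 0 * \<bar>v N\<bar>"
    using \<theta> by (intro tendsto_intros LIMSEQ_realpow_zero)
  then have "\<forall>\<^sub>F n in sequentially. \<theta> ^ n * \<bar>v N\<bar> < \<epsilon> / 2"
    using \<epsilon> by (intro order_tendstoD(2)) auto
  then obtain M where M: "\<theta> ^ n * \<bar>v N\<bar> < \<epsilon> / 2" if "M \<le> n" for n
    unfolding eventually_sequentially by blast
  have "norm (v n - 0) < \<epsilon>" if "M + N \<le> n" for n
  proof -
    have "n - N + N = n" "M \<le> n - N" using that by auto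
    then show ?thesis using bound[of "n - N"] M[of "n - N"] by simp
  qed
  then show "\<exists>no. \<forall>n\<ge>no. norm (v n - 0) < \<epsilon>" by blast
qed

text \<open>Centring at the fixed point \<open>l\<close> of the limiting map
  \<open>x \<mapsto> q' * x + r'\<close> leaves a contraction perturbed by
  \<open>q n * l + r n - l\<close>, which tends to 0.\<close>

lemma affine_recursion_tendsto:
  fixes u q r :: "nat \<Rightarrow> real"
  assumes q: "q \<longlonglongrightarrow> q'" "\<bar>q'\<bar> < 1" and r: "r \<longlonglongrightarrow> r'"
    and step: "\<forall>\<^sub>F n in sequentially. u (Suc n) = q n * u n + r n"
  shows "u \<longlonglongrightarrow> r' / (1 - q')"
proof -
  define l where "l = r' / (1 - q')"
  have l: "l = q' * l + r'" using q(2) by (simp add: l_def field_simps)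
  \<comment> \<open>The midpoint of \<open>\<bar>q'\<bar>\<close> and 1: it eventually dominates
    \<open>\<bar>q n\<bar>\<close> and is still a contraction factor.\<close>
  define \<theta> where "\<theta> = (1 + \<bar>q'\<bar>) / 2"
  have \<theta>: "0 \<le> \<theta>" "\<theta> < 1" "\<bar>q'\<bar> < \<theta>" using q(2) by (auto simp: \<theta>_def)
  have "(\<lambda>n. q n * l + r n - l) \<longlonglongrightarrow> q' * l + r' - l"
    by (intro tendsto_intros q r)
  then have rest: "(\<lambda>n. \<bar>q n * l + r n - l\<bar>) \<longlonglongrightarrow> 0"
    using l by (simp add: tendsto_rabs_zero)
  have "\<forall>\<^sub>F n in sequentially. \<bar>q n\<bar> < \<theta>"
    using tendsto_rabs[OF q(1)] \<theta>(3) by (rule order_tendstoD(2))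
  with step have "\<forall>\<^sub>F n in sequentially.
      \<bar>u (Suc n) - l\<bar> \<le> \<theta> * \<bar>u n - l\<bar> + \<bar>q n * l + r n - l\<bar>"
  proof eventually_elim
    case (elim n)
    have "u (Suc n) - l = q n * (u n - l) + (q n * l + r n - l)"
      using elim(1) by (simp add: algebra_simps)
    then have "\<bar>u (Suc n) - l\<bar> \<le> \<bar>q n\<bar> * \<bar>u n - l\<bar> + \<bar>q n * l + r n - l\<bar>"
      using abs_triangle_ineq by (metis abs_mult)
    also have "\<bar>q n\<bar> * \<bar>u n - l\<bar> \<le> \<theta> * \<bar>u n - l\<bar>"
      using elim(2) by (intro mult_right_mono) auto
    finally show ?case by simp
  qed
  then have "(\<lambda>n. u n - l) \<longlonglongrightarrow> 0"
    by (intro perturbed_contraction_tendsto_0[OF \<theta>(1,2) rest])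
  then show ?thesis unfolding l_def[symmetric] by (simp add: LIM_zero_iff)
qed

text \<open>The increments of \<open>g\<close> telescope and are summable by comparison. The
  distance to \<open>g m\<close> is bounded by the whole sum of \<open>v\<close> instead of its tail
  from \<open>m\<close>; this bound is the same for every starting index, which later gives
  uniformity in \<open>m\<close>.\<close>

lemma convergent_of_summable_majorant:
  fixes g v :: "nat \<Rightarrow> real"
  assumes v: "summable v" "\<And>k. 0 \<le> v k"
    and step: "\<And>k. m \<le> k \<Longrightarrow> \<bar>g (Suc k) - g k\<bar> \<le> v k"
  obtains l where "g \<longlonglongrightarrow> l" "\<bar>l - g m\<bar> \<le> suminf v"
proof -
  let ?h = "\<lambda>n. g (n + m)"
  have step': "\<bar>?h (Suc n) - ?h n\<bar> \<le> v (n + m)" for n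
    using step[of "n + m"] by simp
  have sv: "summable (\<lambda>n. v (n + m))" using v(1) by simp
  have "summable (\<lambda>n. ?h (Suc n) - ?h n)"
    by (rule summable_comparison_test'[OF sv]) (use step' in simp)
  then have "(\<lambda>n. \<Sum>k<n. ?h (Suc k) - ?h k) \<longlonglongrightarrow> (\<Sum>k. ?h (Suc k) - ?h k)"
    by (rule summable_LIMSEQ)
  then have lim: "(\<lambda>n. ?h n - g m) \<longlonglongrightarrow> (\<Sum>k. ?h (Suc k) - ?h k)"
    by (subst (asm) sum_lessThan_telescope) simp
  define l where "l = (\<Sum>k. ?h (Suc k) - ?h k) + g m"
  have "(\<lambda>n. (?h n - g m) + g m) \<longlonglongrightarrow> l"
    unfolding l_def by (intro tendsto_intros lim)
  then have "g \<longlonglongrightarrow> l" by (intro LIMSEQ_offset[of g m]) simp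
  moreover have "\<bar>?h n - g m\<bar> \<le> suminf v" for n
  proof -
    have "\<bar>?h n - g m\<bar> = \<bar>\<Sum>k<n. ?h (Suc k) - ?h k\<bar>"
      by (subst sum_lessThan_telescope) simp
    also have "\<dots> \<le> (\<Sum>k<n. v (k + m))"
      by (intro order_trans[OF sum_abs] sum_mono step')
    also have "\<dots> = sum v {m..<m+n}"
      by (rule sum.reindex_bij_witness[of _ "\<lambda>i. i - m" "\<lambda>i. i + m"]) auto
    also have "\<dots> \<le> suminf v"
      using v by (intro sum_le_suminf) auto
    finally show ?thesis .
  qed
  then have "\<bar>l - g m\<bar> \<le> suminf v"
    using tendsto_rabs[OF lim] by (intro LIMSEQ_le_const2[of "\<lambda>n. \<bar>?h n - g m\<bar>"]) (auto simp: l_def)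
  ultimately show thesis by (rule that)
qed

lemma abs_ln_diff_le:
  fixes x y c :: real
  assumes "0 < c" "c \<le> x" "c \<le> y"
  shows "\<bar>ln x - ln y\<bar> \<le> \<bar>x - y\<bar> / c"
proof -
  have *: "ln u - ln w \<le> \<bar>u - w\<bar> / c" if "c \<le> u" "c \<le> w" for u w
  proof -
    have "ln u - ln w = ln (u / w)" using that assms(1) by (subst ln_div) auto
    also have "\<dots> \<le> u / w - 1" using that assms(1) by (intro ln_le_minus_one) auto
    also have "\<dots> = (u - w) / w" using that assms(1) by (simp add: field_simps)
    also have "\<dots> \<le> \<bar>u - w\<bar> / w" using that assms(1) by (intro divide_right_mono) auto
    also have "\<dots> \<le> \<bar>u - w\<bar> / c" using that assms(1) by (intro divide_left_mono) auto
    finally show ?thesis .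
  qed
  show ?thesis using *[of x y] *[of y x] assms by (simp add: abs_le_iff abs_minus_commute)
qed

text \<open>For \<open>p \<le> q\<close> the quotient \<open>(x + q * y) / (x + p * y)\<close> lies
  between 1 and \<open>q / p\<close>, because enlarging \<open>x\<close> to
  \<open>(q / p) * x\<close> makes the numerator a multiple of the denominator. The other case
  follows by exchanging \<open>p\<close> and \<open>q\<close>.\<close>

lemma abs_ln_combination_diff_le:
  fixes p q x y :: real
  assumes "0 < p" "0 < q" "0 < x" "0 \<le> y"
  shows "\<bar>ln (x + q * y) - ln (x + p * y)\<bar> \<le> \<bar>ln q - ln p\<bar>"
proof -
  have *: "\<bar>ln (x + q * y) - ln (x + p * y)\<bar> \<le> \<bar>ln q - ln p\<bar>" if "0 < p" "p \<le> q" for p q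
  proof -
    have pos: "0 < x + p * y" "0 < x + q * y"
      using that assms by (auto intro!: add_pos_nonneg)
    have le: "x + p * y \<le> x + q * y" using that assms by (auto intro: mult_right_mono)
    have "p * x \<le> q * x" using that assms by (intro mult_right_mono) auto
    then have "x + q * y \<le> (q / p) * (x + p * y)"
      using that by (simp add: field_simps)
    then have "ln (x + q * y) \<le> ln ((q / p) * (x + p * y))"
      using pos that by (subst ln_le_cancel_iff) auto
    also have "\<dots> = ln q - ln p + ln (x + p * y)"
      using pos that by (simp add: ln_mult ln_div)
    finally show ?thesis using le pos that by simp
  qed
  show ?thesis
    using *[of p q] *[of q p] assms by (cases "p \<le> q") (auto simp: abs_minus_commute)
qed

section \<open>The Perron root of a step matrix\<close>

text \<open>The larger root of \<open>t\<^sup>2 = \<alpha> * t + \<beta> * \<delta>\<close>, the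
  characteristic equation of the matrix with rows \<open>(\<alpha>, \<beta>)\<close> and
  \<open>(\<delta>, 0)\<close>.\<close>

definition perron :: "real \<Rightarrow> real \<Rightarrow> real \<Rightarrow> real" where
  "perron \<alpha> \<beta> \<delta> = (\<alpha> + sqrt (\<alpha>\<^sup>2 + 4 * \<beta> * \<delta>)) / 2"

lemma perron_eq:
  assumes "0 < \<beta>" "0 < \<delta>"
  shows "perron \<alpha> \<beta> \<delta> * perron \<alpha> \<beta> \<delta> = \<alpha> * perron \<alpha> \<beta> \<delta> + \<beta> * \<delta>"
proof -
  have "0 \<le> \<alpha>\<^sup>2 + 4 * \<beta> * \<delta>" using assms by simp
  then have "(2 * perron \<alpha> \<beta> \<delta> - \<alpha>)\<^sup>2 = \<alpha>\<^sup>2 + 4 * \<beta> * \<delta>"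
    by (simp add: perron_def add_divide_distrib)
  then show ?thesis by (simp add: power2_eq_square algebra_simps)
qed

lemma perron_gt:
  assumes "0 < \<alpha>" "0 < \<beta>" "0 < \<delta>"
  shows "\<alpha> < perron \<alpha> \<beta> \<delta>"
proof -
  have "\<alpha> < sqrt (\<alpha>\<^sup>2 + 4 * \<beta> * \<delta>)" using assms by (intro real_less_rsqrt) simp
  then show ?thesis by (simp add: perron_def)
qed

text \<open>Subtracting the two quadratic equations factors out the difference of the roots. The
  cofactor stays away from 0 since each root exceeds its first coefficient, so the root is Lipschitz
  in the entries.\<close>

lemma perron_diff_le:
  assumes "0 < \<sigma>" "\<sigma> \<le> \<alpha>" "\<sigma> \<le> \<beta>" "\<sigma> \<le> \<delta>" "\<sigma> \<le> \<alpha>'" "\<sigma> \<le> \<beta>'" "\<sigma> \<le> \<delta>'" "\<beta> \<le> M" "\<delta>' \<le> M"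
  shows "\<bar>perron \<alpha>' \<beta>' \<delta>' - perron \<alpha> \<beta> \<delta>\<bar>
    \<le> \<bar>\<alpha>' - \<alpha>\<bar> + (M / \<sigma>) * (\<bar>\<beta>' - \<beta>\<bar> + \<bar>\<delta>' - \<delta>\<bar>)"
proof -
  define l where "l = perron \<alpha> \<beta> \<delta>"
  define l' where "l' = perron \<alpha>' \<beta>' \<delta>'"
  have l: "\<alpha> < l" "l * l = \<alpha> * l + \<beta> * \<delta>" and l': "\<alpha>' < l'" "l' * l' = \<alpha>' * l' + \<beta>' * \<delta>'"
    using assms by (auto simp: l_def l'_def intro: perron_gt perron_eq)
  have pos: "0 < l" using l assms by linarith
  \<comment> \<open>The change of \<open>\<beta> * \<delta>\<close> is split so that
    \<open>\<delta>'\<close> and \<open>\<beta>\<close> appear as coefficients; these are the two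
    quantities bounded by \<open>M\<close>.\<close>
  have "(l' - l) * (l' + l - \<alpha>') = (\<alpha>' - \<alpha>) * l + (\<beta>' - \<beta>) * \<delta>' + \<beta> * (\<delta>' - \<delta>)"
    using l(2) l'(2) by (simp add: algebra_simps)
  then have "\<bar>l' - l\<bar> * \<bar>l' + l - \<alpha>'\<bar> = \<bar>(\<alpha>' - \<alpha>) * l + (\<beta>' - \<beta>) * \<delta>' + \<beta> * (\<delta>' - \<delta>)\<bar>"
    by (metis abs_mult)
  also have "\<dots> \<le> \<bar>\<alpha>' - \<alpha>\<bar> * l + \<bar>\<beta>' - \<beta>\<bar> * \<delta>' + \<beta> * \<bar>\<delta>' - \<delta>\<bar>"
    using pos assms by (intro order_trans[OF abs_triangle_ineq] add_mono) (auto simp: abs_mult)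
  also have "\<dots> \<le> \<bar>\<alpha>' - \<alpha>\<bar> * l + \<bar>\<beta>' - \<beta>\<bar> * M + M * \<bar>\<delta>' - \<delta>\<bar>"
    using assms by (intro add_mono mult_left_mono mult_right_mono) auto
  also have "\<dots> = \<bar>\<alpha>' - \<alpha>\<bar> * l + M * (\<bar>\<beta>' - \<beta>\<bar> + \<bar>\<delta>' - \<delta>\<bar>)"
    by (simp add: algebra_simps)
  finally have up: "\<bar>l' - l\<bar> * \<bar>l' + l - \<alpha>'\<bar> \<le> \<dots>" .
  \<comment> \<open>As \<open>\<alpha>' < l'\<close>, the cofactor \<open>l' + l - \<alpha>'\<close>
    is larger than \<open>l\<close>, and \<open>l\<close> in turn exceeds
    \<open>\<sigma>\<close>.\<close>
  have "\<bar>l' - l\<bar> * l \<le> \<bar>l' - l\<bar> * \<bar>l' + l - \<alpha>'\<bar>"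
    using l'(1) by (intro mult_left_mono) auto
  with up have "\<bar>l' - l\<bar> * l \<le> \<bar>\<alpha>' - \<alpha>\<bar> * l + M * (\<bar>\<beta>' - \<beta>\<bar> + \<bar>\<delta>' - \<delta>\<bar>)" by linarith
  then have "\<bar>l' - l\<bar> \<le> \<bar>\<alpha>' - \<alpha>\<bar> + M * (\<bar>\<beta>' - \<beta>\<bar> + \<bar>\<delta>' - \<delta>\<bar>) / l"
    using pos by (simp add: field_simps)
  also have "M * (\<bar>\<beta>' - \<beta>\<bar> + \<bar>\<delta>' - \<delta>\<bar>) / l \<le> M * (\<bar>\<beta>' - \<beta>\<bar> + \<bar>\<delta>' - \<delta>\<bar>) / \<sigma>"
    using assms l(1) by (intro divide_left_mono mult_nonneg_nonneg) auto
  finally show ?thesis by (simp add: l_def l'_def)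
qed

section \<open>The spectral radius of a step matrix\<close>

lemma step_mat_carrier [simp]: "step_mat a b d k \<in> carrier_mat 2 2"
  by (simp add: step_mat_def mat_of_rows_list_def numeral_2_eq_2)

lemma step_mat_index:
  "step_mat a b d k $$ (0, 0) = a k" "step_mat a b d k $$ (0, Suc 0) = b k"
  "step_mat a b d k $$ (Suc 0, 0) = d k" "step_mat a b d k $$ (Suc 0, Suc 0) = 0"
  by (simp_all add: step_mat_def mat_of_rows_list_def)

text \<open>An explicit eigenvector shows that the Perron root is an eigenvalue. Conversely, the
  norm of any complex eigenvalue satisfies the characteristic equation as an inequality, which
  forces it below the Perron root.\<close>

lemma real_spectral_radius_step_mat:
  assumes pos: "0 < a k" "0 < b k" "0 < d k"
  shows "real_spectral_radius (step_mat a b d k) = perron (a k) (b k) (d k)"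
proof -
  define \<rho> where "\<rho> = perron (a k) (b k) (d k)"
  define A where "A = map_mat complex_of_real (step_mat a b d k)"
  have \<rho>: "a k < \<rho>" "\<rho> * \<rho> = a k * \<rho> + b k * d k"
    using pos by (simp_all add: \<rho>_def perron_gt perron_eq)
  have A: "A \<in> carrier_mat 2 2" by (simp add: A_def)
  have dims: "dim_row A = 2" "dim_col A = 2" using A by auto
  have dims': "dim_row (step_mat a b d k) = 2" "dim_col (step_mat a b d k) = 2"
    using step_mat_carrier by (blast dest: carrier_matD)+
  have entries: "A $$ (0, 0) = a k" "A $$ (0, Suc 0) = b k" "A $$ (Suc 0, 0) = d k"
      "A $$ (Suc 0, Suc 0) = 0"
    by (simp_all add: A_def step_mat_index dims')
  have mult: "(A *\<^sub>v v) $ 0 = a k * v $ 0 + b k * v $ Suc 0"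
      "(A *\<^sub>v v) $ Suc 0 = d k * v $ 0"
    if "v \<in> carrier_vec 2" for v
    using that by (auto simp: dims scalar_prod_def numeral_2_eq_2 entries)
  \<comment> \<open>The vector \<open>(\<rho>, d k)\<close>: its second row is immediate and its
    first row is the quadratic equation of \<open>\<rho>\<close>.\<close>
  have "eigenvector A (vec 2 (\<lambda>i. if i = 0 then complex_of_real \<rho> else d k)) \<rho>"
  proof -
    let ?v = "vec 2 (\<lambda>i. if i = 0 then complex_of_real \<rho> else d k)"
    have "A *\<^sub>v ?v = complex_of_real \<rho> \<cdot>\<^sub>v ?v"
    proof (rule eq_vecI)
      fix i assume "i < dim_vec (complex_of_real \<rho> \<cdot>\<^sub>v ?v)"
      then have "i = 0 \<or> i = 1" by auto
      then show "(A *\<^sub>v ?v) $ i = (complex_of_real \<rho> \<cdot>\<^sub>v ?v) $ i"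
        using \<rho>(2) by (auto simp: mult simp flip: of_real_mult of_real_add)
    qed (simp add: dims)
    moreover have "?v $ 1 \<noteq> 0\<^sub>v 2 $ 1" using pos by simp
    then have "?v \<noteq> 0\<^sub>v 2" by metis
    ultimately show ?thesis by (auto simp: eigenvector_def dims)
  qed
  then have "complex_of_real \<rho> \<in> spectrum A" by (auto simp: spectrum_def eigenvalue_def)
  then have "norm (complex_of_real \<rho>) \<in> norm ` spectrum A" by (rule imageI)
  then have "\<rho> \<le> spectral_radius A"
    using spectral_radius_mem_max(2)[OF A] \<rho>(1) pos by fastforce
  moreover have "spectral_radius A \<le> \<rho>"
  proof -
    obtain e where e: "e \<in> spectrum A" "spectral_radius A = norm e"
      using spectral_radius_mem_max(1)[OF A] by auto
    then obtain v where v: "v \<in> carrier_vec 2" "v \<noteq> 0\<^sub>v 2" "A *\<^sub>v v = e \<cdot>\<^sub>v v"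
      by (auto simp: spectrum_def eigenvalue_def eigenvector_def dims)
    have v0: "e * v $ 0 = a k * v $ 0 + b k * v $ 1" and v1: "e * v $ 1 = d k * v $ 0"
      using mult[OF v(1)] v(1) by (simp_all add: v(3))
    have "v $ 0 \<noteq> 0"
    proof
      assume "v $ 0 = 0"
      moreover from this have "v $ 1 = 0" using v0 pos by simp
      ultimately have "v = 0\<^sub>v 2"
        using v(1) by (intro eq_vecI) (auto simp: less_2_cases_iff)
      with v(2) show False ..
    qed
    moreover have "e * e * v $ 0 = (a k * e + b k * d k) * v $ 0"
    proof -
      have "e * e * v $ 0 = e * (a k * v $ 0 + b k * v $ 1)" by (simp only: mult.assoc v0)
      also have "\<dots> = a k * e * v $ 0 + b k * (e * v $ 1)" by (simp only: algebra_simps)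
      also have "\<dots> = (a k * e + b k * d k) * v $ 0"
        by (simp add: v1[unfolded One_nat_def] algebra_simps)
      finally show ?thesis .
    qed
    ultimately have "e * e = a k * e + b k * d k" by simp
    then have "norm e * norm e \<le> a k * norm e + b k * d k"
      using norm_triangle_ineq[of "a k * e" "b k * d k"] pos
      by (simp flip: norm_mult) (simp add: norm_mult)
    \<comment> \<open>Subtracting the equation of \<open>\<rho>\<close> makes the inequality factor;
      the second factor is positive because \<open>a k < \<rho>\<close>.\<close>
    then have "(norm e - \<rho>) * (norm e + \<rho> - a k) \<le> 0"
      using \<rho>(2) by (simp add: algebra_simps)
    moreover have "0 < norm e + \<rho> - a k" using \<rho>(1) norm_ge_zero[of e] by linarith
    ultimately have "norm e \<le> \<rho>" by (simp add: mult_le_0_iff)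
    then show ?thesis using e by simp
  qed
  ultimately show ?thesis by (simp add: real_spectral_radius_def A_def \<rho>_def)
qed

section \<open>Products of step matrices\<close>

lemma backward_prod_self: "backward_prod (step_mat a b d) m m = step_mat a b d m"
  by (simp add: backward_prod_def right_mult_one_mat[OF step_mat_carrier])

text \<open>The reversed list begins with its largest index, so the newest factor stands on the
  left. For \<open>m = Suc k\<close> the remaining product is the identity.\<close>

lemma backward_prod_Suc:
  "m \<le> Suc k \<Longrightarrow> backward_prod A m (Suc k) = A (Suc k) * backward_prod A m k"
  by (simp add: backward_prod_def)

lemma backward_prod_carrier [simp]:
  "m \<le> k \<Longrightarrow> backward_prod (step_mat a b d) m k \<in> carrier_mat 2 2"
  by (induction k rule: dec_induct)
    (auto simp: backward_prod_self backward_prod_Suc intro!: mult_carrier_mat[of _ 2 2])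

text \<open>Left multiplication acts on each column separately, so a fixed column is a pair obeying
  a linear recursion. The zero entry of the step matrix leaves a single term in the second
  row.\<close>

lemma backward_prod_Suc_index:
  assumes "m \<le> k" "j < 2"
  shows "backward_prod (step_mat a b d) m (Suc k) $$ (0, j) =
      a (Suc k) * backward_prod (step_mat a b d) m k $$ (0, j)
      + b (Suc k) * backward_prod (step_mat a b d) m k $$ (Suc 0, j)"
    and "backward_prod (step_mat a b d) m (Suc k) $$ (Suc 0, j) =
      d (Suc k) * backward_prod (step_mat a b d) m k $$ (0, j)"
proof -
  have dims: "dim_row (backward_prod (step_mat a b d) m k) = 2"
      "dim_col (backward_prod (step_mat a b d) m k) = 2"
      "dim_row (step_mat a b d (Suc k)) = 2" "dim_col (step_mat a b d (Suc k)) = 2"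
    using step_mat_carrier backward_prod_carrier[OF assms(1)] by (blast dest: carrier_matD)+
  show "backward_prod (step_mat a b d) m (Suc k) $$ (0, j) =
      a (Suc k) * backward_prod (step_mat a b d) m k $$ (0, j)
      + b (Suc k) * backward_prod (step_mat a b d) m k $$ (Suc 0, j)"
    and "backward_prod (step_mat a b d) m (Suc k) $$ (Suc 0, j) =
      d (Suc k) * backward_prod (step_mat a b d) m k $$ (0, j)"
    using assms
    by (simp_all add: backward_prod_Suc dims scalar_prod_def numeral_2_eq_2 step_mat_index)
qed

section \<open>Normalised products under bounded variation\<close>

locale bounded_variation_steps =
  fixes a b d :: "nat \<Rightarrow> real" and \<sigma> :: real
  assumes sigma: "0 < \<sigma>"
    and lower: "1 \<le> k \<Longrightarrow> \<sigma> \<le> a k \<and> \<sigma> \<le> b k \<and> \<sigma> \<le> d k"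
    and variation: "summable (\<lambda>k. \<bar>a (k + 2) - a (k + 1)\<bar> + \<bar>b (k + 2) - b (k + 1)\<bar>
                                 + \<bar>d (k + 2) - d (k + 1)\<bar>)"
begin

definition perron_root :: "nat \<Rightarrow> real" where "perron_root k = perron (a k) (b k) (d k)"

text \<open>The number \<open>p\<^sub>k\<close>: the second coordinate of the left Perron
  eigenvector whose first coordinate is 1.\<close>

definition weight :: "nat \<Rightarrow> real" where "weight k = b k / perron_root k"

text \<open>The term at \<open>k = 0\<close> involves the unconstrained values \<open>a 0\<close>, \<open>b 0\<close>, \<open>d 0\<close>; it is harmless,
  since only an upper bound for the variation over \<open>k \<ge> 1\<close> is needed.\<close>

definition weight_variation :: real where
  "weight_variation = (\<Sum>k. \<bar>ln (weight (Suc k)) - ln (weight k)\<bar>)"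

lemma pos: "1 \<le> k \<Longrightarrow> 0 < a k \<and> 0 < b k \<and> 0 < d k"
  using lower[of k] sigma by auto

lemma lim_abd:
  shows "a \<longlonglongrightarrow> lim a" "0 < lim a" "b \<longlonglongrightarrow> lim b" "0 < lim b" "d \<longlonglongrightarrow> lim d" "0 < lim d"
proof -
  have "summable (\<lambda>k. \<bar>a (k + 2) - a (k + 1)\<bar>)" "summable (\<lambda>k. \<bar>b (k + 2) - b (k + 1)\<bar>)"
      "summable (\<lambda>k. \<bar>d (k + 2) - d (k + 1)\<bar>)"
    by (rule summable_comparison_test'[OF variation]; simp)+
  then show "a \<longlonglongrightarrow> lim a" "0 < lim a" "b \<longlonglongrightarrow> lim b" "0 < lim b" "d \<longlonglongrightarrow> lim d" "0 < lim d"
    using lower sigma by (blast intro: bounded_variation_limit)+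
qed

definition perron_root_lim :: real where "perron_root_lim = perron (lim a) (lim b) (lim d)"

lemma perron_root_gt: "1 \<le> k \<Longrightarrow> a k < perron_root k"
  using pos by (simp add: perron_root_def perron_gt)

lemma perron_root_pos: "1 \<le> k \<Longrightarrow> 0 < perron_root k"
  using perron_root_gt pos less_trans by blast

lemma perron_root_lim_gt: "lim a < perron_root_lim"
  by (simp add: perron_root_lim_def perron_gt lim_abd)

lemma perron_root_lim_pos: "0 < perron_root_lim"
  using perron_root_lim_gt lim_abd by linarith

lemma perron_root_tendsto: "perron_root \<longlonglongrightarrow> perron_root_lim"
  unfolding perron_root_def perron_root_lim_def perron_def by (intro tendsto_intros lim_abd) simp

lemma weight_pos: "1 \<le> k \<Longrightarrow> 0 < weight k"
  using perron_root_pos pos by (simp add: weight_def)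

lemma weight_tendsto: "weight \<longlonglongrightarrow> lim b / perron_root_lim"
  unfolding weight_def using perron_root_lim_pos by (intro tendsto_intros lim_abd perron_root_tendsto) simp

text \<open>The entries and the Perron roots are at least \<open>\<sigma>\<close>, where the
  logarithm is Lipschitz with constant \<open>1 / \<sigma>\<close>. Since the Perron root is
  Lipschitz in the entries, the variation of \<open>ln (weight k)\<close> is at most a constant
  times that of the entries.\<close>

lemma summable_ln_weight: "summable (\<lambda>k. \<bar>ln (weight (Suc k)) - ln (weight k)\<bar>)"
proof -
  have "Bseq b" "Bseq d"
    using lim_abd by (auto intro: convergent_imp_Bseq convergentI)
  then obtain Mb Md where M: "\<And>k. \<bar>b k\<bar> \<le> Mb" "\<And>k. \<bar>d k\<bar> \<le> Md"
    unfolding Bseq_def by auto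
  define M where "M = max Mb Md"
  have bM: "b k \<le> M" and dM: "d k \<le> M" for k
    using M(1)[of k] M(2)[of k] by (auto simp: M_def)
  have M_pos: "0 < M" using bM[of 1] pos[of 1] by simp
  let ?v = "\<lambda>k. \<bar>a (Suc (Suc k)) - a (Suc k)\<bar> + \<bar>b (Suc (Suc k)) - b (Suc k)\<bar>
    + \<bar>d (Suc (Suc k)) - d (Suc k)\<bar>"
  \<comment> \<open>The outer \<open>1 / \<sigma>\<close> comes from the logarithm,
    \<open>M / \<sigma>\<close> from the Perron root estimate, and 2 counts the separate differences
    of \<open>b\<close> and \<open>a\<close>, each at most \<open>?v k\<close>.\<close>
  have "summable (\<lambda>k. (2 + M / \<sigma>) / \<sigma> * ?v k)"
    using variation by (intro summable_mult) simp
  moreover have "norm \<bar>ln (weight (Suc (Suc k))) - ln (weight (Suc k))\<bar>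
      \<le> (2 + M / \<sigma>) / \<sigma> * ?v k" for k
  proof -
    let ?k = "Suc k"
    have ln_weight: "ln (weight n) = ln (b n) - ln (perron_root n)" if "1 \<le> n" for n
      using pos[OF that] perron_root_pos[OF that] by (simp add: weight_def ln_div)
    have low: "\<sigma> \<le> b n" "\<sigma> \<le> perron_root n" if "1 \<le> n" for n
      using lower[OF that] perron_root_gt[OF that] by auto
    have "\<bar>ln (b (Suc ?k)) - ln (b ?k)\<bar> \<le> \<bar>b (Suc ?k) - b ?k\<bar> / \<sigma>"
      "\<bar>ln (perron_root (Suc ?k)) - ln (perron_root ?k)\<bar> \<le> \<bar>perron_root (Suc ?k) - perron_root ?k\<bar> / \<sigma>"
      by (intro abs_ln_diff_le sigma low; simp)+
    then have "\<bar>ln (weight (Suc ?k)) - ln (weight ?k)\<bar>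
        \<le> \<bar>b (Suc ?k) - b ?k\<bar> / \<sigma> + \<bar>perron_root (Suc ?k) - perron_root ?k\<bar> / \<sigma>"
      by (simp add: ln_weight)
    also have "\<dots> = (\<bar>b (Suc ?k) - b ?k\<bar> + \<bar>perron_root (Suc ?k) - perron_root ?k\<bar>) / \<sigma>"
      by (simp add: add_divide_distrib)
    also have "\<dots> \<le> ((2 + M / \<sigma>) * ?v k) / \<sigma>"
    proof (intro divide_right_mono)
      have "\<bar>perron_root (Suc ?k) - perron_root ?k\<bar> \<le> \<bar>a (Suc ?k) - a ?k\<bar>
          + (M / \<sigma>) * (\<bar>b (Suc ?k) - b ?k\<bar> + \<bar>d (Suc ?k) - d ?k\<bar>)"
        unfolding perron_root_def using lower[of ?k] lower[of "Suc ?k"]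
        by (intro perron_diff_le sigma bM dM) auto
      also have "\<dots> \<le> \<bar>a (Suc ?k) - a ?k\<bar> + (M / \<sigma>) * ?v k"
        using M_pos sigma by (intro add_left_mono mult_left_mono) auto
      finally have "\<bar>b (Suc ?k) - b ?k\<bar> + \<bar>perron_root (Suc ?k) - perron_root ?k\<bar>
          \<le> \<bar>b (Suc ?k) - b ?k\<bar> + (\<bar>a (Suc ?k) - a ?k\<bar> + (M / \<sigma>) * ?v k)"
        by (rule add_left_mono)
      also have "\<dots> = (\<bar>b (Suc ?k) - b ?k\<bar> + \<bar>a (Suc ?k) - a ?k\<bar>) + (M / \<sigma>) * ?v k"
        by (rule add.assoc[symmetric])
      also have "\<dots> \<le> 2 * ?v k + (M / \<sigma>) * ?v k"
        by (rule add_right_mono) simp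
      also have "\<dots> = (2 + M / \<sigma>) * ?v k"
        by (rule distrib_right[symmetric])
      finally show "\<bar>b (Suc ?k) - b ?k\<bar> + \<bar>perron_root (Suc ?k) - perron_root ?k\<bar>
          \<le> (2 + M / \<sigma>) * ?v k" .
    qed (use sigma in simp)
    finally show ?thesis by simp
  qed
  ultimately have "summable (\<lambda>k. \<bar>ln (weight (Suc (Suc k))) - ln (weight (Suc k))\<bar>)"
    by (rule summable_comparison_test')
  \<comment> \<open>The estimate covers indices from 1 on; adding the one term at 0 preserves
    summability.\<close>
  then show ?thesis
    by (rule summable_Suc_iff[THEN iffD1])
qed

text \<open>The initial data enter the limits only through \<open>s\<close>, the limit of
  \<open>ln (S k)\<close>. The denominator is 1 minus the limiting coefficient
  \<open>lim a / perron_root_lim - 1\<close> of the recursion for \<open>X\<close>.\<close>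

lemma normalised_recursion_tendsto:
  assumes m: "1 \<le> m"
    and X: "\<And>k. m \<le> k \<Longrightarrow> X (Suc k) = (a (Suc k) * X k + b (Suc k) * Y k) / perron_root (Suc k)"
    and Y: "\<And>k. m \<le> k \<Longrightarrow> Y (Suc k) = d (Suc k) * X k / perron_root (Suc k)"
    and init: "0 < X m" "0 \<le> Y m"
  obtains s where "\<bar>s - ln (X m + weight m * Y m)\<bar> \<le> weight_variation"
    "X \<longlonglongrightarrow> exp s / (2 - lim a / perron_root_lim)"
    "Y \<longlonglongrightarrow> lim d / perron_root_lim * (exp s / (2 - lim a / perron_root_lim))"
proof -
  define S where "S k = X k + weight k * Y k" for k
  have XY: "0 < X k \<and> 0 \<le> Y k" if "m \<le> k" for k
    using that
  proof (induction k rule: dec_induct)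
    case (step k)
    then show ?case using m pos[of "Suc k"] perron_root_pos[of "Suc k"]
      by (auto simp: X Y intro!: divide_pos_pos add_pos_nonneg)
  qed (use init in simp)
  have S_pos: "0 < S k" if "m \<le> k" for k
    using XY[OF that] weight_pos[of k] m that
    by (auto simp: S_def intro!: add_pos_nonneg)
  have S_Suc: "S (Suc k) = X k + weight (Suc k) * Y k" if "m \<le> k" for k
  proof -
    define l where "l = perron_root (Suc k)"
    have l: "l * l = a (Suc k) * l + b (Suc k) * d (Suc k)" "0 < l"
      using m that pos[of "Suc k"] perron_root_pos[of "Suc k"] by (auto simp: l_def perron_root_def perron_eq)
    have "S (Suc k) = (a (Suc k) * X k + b (Suc k) * Y k) / l + b (Suc k) / l * (d (Suc k) * X k / l)"
      using that by (simp add: S_def weight_def X Y l_def)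
    \<comment> \<open>Over the denominator \<open>l * l\<close> the coefficient of
      \<open>X k\<close> is the right side of the Perron equation, hence cancels.\<close>
    also have "\<dots> = ((a (Suc k) * l + b (Suc k) * d (Suc k)) * X k + b (Suc k) * l * Y k) / (l * l)"
      using l(2) by (simp add: field_simps)
    also have "\<dots> = X k + b (Suc k) / l * Y k"
      unfolding l(1)[symmetric] using l(2) by (simp add: field_simps)
    finally show ?thesis by (simp add: weight_def l_def)
  qed
  have "\<bar>ln (S (Suc k)) - ln (S k)\<bar> \<le> \<bar>ln (weight (Suc k)) - ln (weight k)\<bar>" if "m \<le> k" for k
    unfolding S_Suc[OF that] S_def[of k]
    using XY[OF that] weight_pos[of k] weight_pos[of "Suc k"] m that
    by (intro abs_ln_combination_diff_le) auto
  then obtain s where s: "(\<lambda>k. ln (S k)) \<longlonglongrightarrow> s" "\<bar>s - ln (S m)\<bar> \<le> weight_variation"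
    unfolding weight_variation_def
    by (rule convergent_of_summable_majorant[OF summable_ln_weight, rotated]) auto
  have ev: "\<forall>\<^sub>F k in sequentially. m \<le> k" by (rule eventually_ge_at_top)
  have "(\<lambda>k. exp (ln (S k))) \<longlonglongrightarrow> exp s" by (intro tendsto_intros s)
  moreover have "\<forall>\<^sub>F k in sequentially. exp (ln (S k)) = S k"
    using ev by eventually_elim (simp add: S_pos)
  ultimately have S_lim: "S \<longlonglongrightarrow> exp s" by (rule Lim_transform_eventually)
  define p where "p = lim b / perron_root_lim"
  have p: "weight \<longlonglongrightarrow> p" "p \<noteq> 0"
    using weight_tendsto lim_abd perron_root_lim_pos by (auto simp: p_def)
  define q where "q = lim a / perron_root_lim"
  have q: "0 < q" "q < 1"
    using perron_root_lim_gt perron_root_lim_pos lim_abd by (auto simp: q_def)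
  \<comment> \<open>Substituting \<open>Y k = (S k - X k) / weight k\<close> into the recursion for
    \<open>X\<close> gives the coefficient \<open>?c\<close> and the forcing term
    \<open>?r\<close>.\<close>
  let ?c = "\<lambda>k. a (Suc k) / perron_root (Suc k) - weight (Suc k) / weight k"
  let ?r = "\<lambda>k. weight (Suc k) / weight k * S k"
  have c_lim: "?c \<longlonglongrightarrow> q - p / p"
    unfolding q_def using perron_root_lim_pos p
    by (intro tendsto_intros LIMSEQ_Suc lim_abd perron_root_tendsto) auto
  have r_lim: "?r \<longlonglongrightarrow> p / p * exp s"
    using p by (intro tendsto_intros LIMSEQ_Suc S_lim)
  have "\<forall>\<^sub>F k in sequentially. X (Suc k) = ?c k * X k + ?r k"
    using ev
  proof eventually_elim
    case (elim k)
    have "?c k * X k + ?r k = a (Suc k) / perron_root (Suc k) * X k + weight (Suc k) * Y k"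
      using weight_pos[of k] m elim by (simp add: S_def field_simps)
    then show ?case using elim by (simp add: X weight_def add_divide_distrib)
  qed
  then have "X \<longlonglongrightarrow> (p / p * exp s) / (1 - (q - p / p))"
    using q p by (intro affine_recursion_tendsto[OF c_lim _ r_lim]) auto
  then have X_lim: "X \<longlonglongrightarrow> exp s / (2 - q)" using p by simp
  have "(\<lambda>k. d (Suc k) / perron_root (Suc k) * X k) \<longlonglongrightarrow> lim d / perron_root_lim * (exp s / (2 - q))"
    using perron_root_lim_pos by (intro tendsto_intros LIMSEQ_Suc lim_abd perron_root_tendsto X_lim) auto
  moreover have "\<forall>\<^sub>F k in sequentially. d (Suc k) / perron_root (Suc k) * X k = Y (Suc k)"
    using ev by eventually_elim (simp add: Y)
  ultimately have "(\<lambda>k. Y (Suc k)) \<longlonglongrightarrow> lim d / perron_root_lim * (exp s / (2 - q))"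
    by (rule Lim_transform_eventually)
  then have "Y \<longlonglongrightarrow> lim d / perron_root_lim * (exp s / (2 - q))"
    by (simp add: filterlim_sequentially_Suc)
  with s(2) X_lim show thesis by (intro that) (auto simp: S_def q_def)
qed

text \<open>The bound \<open>B\<close> serves all \<open>m\<close> at once: the initial value of
  \<open>S\<close> is 1 or \<open>weight m\<close>, whose logarithms are bounded, and the later
  drift is at most \<open>weight_variation\<close>.\<close>

lemma normalised_product_tendsto:
  assumes j: "j < 2"
  obtains s B where "\<And>m. 1 \<le> m \<Longrightarrow> \<bar>s m\<bar> \<le> B"
    "\<And>m. 1 \<le> m \<Longrightarrow> (\<lambda>k. backward_prod (step_mat a b d) m k $$ (0, j) / (\<Prod>l = m..k. perron_root l))
        \<longlonglongrightarrow> exp (s m) / (2 - lim a / perron_root_lim)"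
    "\<And>m. 1 \<le> m \<Longrightarrow> (\<lambda>k. backward_prod (step_mat a b d) m k $$ (Suc 0, j) / (\<Prod>l = m..k. perron_root l))
        \<longlonglongrightarrow> lim d / perron_root_lim * (exp (s m) / (2 - lim a / perron_root_lim))"
proof -
  \<comment> \<open>The limit of \<open>weight\<close> is positive, so the logarithms converge and
    are therefore bounded.\<close>
  have "(\<lambda>k. ln (weight k)) \<longlonglongrightarrow> ln (lim b / perron_root_lim)"
    using lim_abd perron_root_lim_pos by (intro tendsto_intros weight_tendsto) auto
  then have "Bseq (\<lambda>k. ln (weight k))" by (intro convergent_imp_Bseq convergentI)
  then obtain W where W: "0 < W" "\<And>k. \<bar>ln (weight k)\<bar> \<le> W" unfolding Bseq_def by auto
  let ?X = "\<lambda>m k. backward_prod (step_mat a b d) m k $$ (0, j) / (\<Prod>l = m..k. perron_root l)"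
  let ?Y = "\<lambda>m k. backward_prod (step_mat a b d) m k $$ (Suc 0, j) / (\<Prod>l = m..k. perron_root l)"
  let ?P = "\<lambda>m s. \<bar>s\<bar> \<le> W + weight_variation \<and>
      ?X m \<longlonglongrightarrow> exp s / (2 - lim a / perron_root_lim) \<and>
      ?Y m \<longlonglongrightarrow> lim d / perron_root_lim * (exp s / (2 - lim a / perron_root_lim))"
  have "\<exists>s. ?P m s" if m: "1 \<le> m" for m
  proof -
    have "?X m (Suc k) = (a (Suc k) * ?X m k + b (Suc k) * ?Y m k) / perron_root (Suc k)"
      and "?Y m (Suc k) = d (Suc k) * ?X m k / perron_root (Suc k)" if "m \<le> k" for k
      using perron_root_pos[of "Suc k"] m that j
      by (simp_all add: backward_prod_Suc_index add_divide_distrib prod.nat_ivl_Suc' mult.commute)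
    moreover have "0 < ?X m m" "0 \<le> ?Y m m"
      using j pos[OF m] perron_root_pos[OF m]
      by (auto simp: backward_prod_self step_mat_index less_2_cases_iff)
    ultimately obtain s where s: "\<bar>s - ln (?X m m + weight m * ?Y m m)\<bar> \<le> weight_variation"
      "?X m \<longlonglongrightarrow> exp s / (2 - lim a / perron_root_lim)"
      "?Y m \<longlonglongrightarrow> lim d / perron_root_lim * (exp s / (2 - lim a / perron_root_lim))"
      by (rule normalised_recursion_tendsto[OF m, of "?X m" "?Y m"]) blast
    have "perron_root m * perron_root m = a m * perron_root m + b m * d m"
      using pos[OF m] by (simp add: perron_root_def perron_eq)
    then have "a m + weight m * d m = perron_root m"
      using perron_root_pos[OF m] by (simp add: weight_def field_simps)
    then have "a m / perron_root m + weight m * (d m / perron_root m) = 1"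
      using perron_root_pos[OF m] by (simp flip: add_divide_distrib)
    \<comment> \<open>Pairing the left eigenvector with the normalised matrix returns the
      eigenvector: 1 on the first column, \<open>weight m\<close> on the second.\<close>
    then have "?X m m + weight m * ?Y m m = (if j = 0 then 1 else weight m)"
      using j by (auto simp: backward_prod_self step_mat_index less_2_cases_iff weight_def)
    then have "\<bar>ln (?X m m + weight m * ?Y m m)\<bar> \<le> W" using W by simp
    then have "\<bar>s\<bar> \<le> W + weight_variation" using s(1) by linarith
    with s show ?thesis by blast
  qed
  then have "\<forall>m\<in>{1..}. \<exists>s. ?P m s" by simp
  from bchoice[OF this] obtain s where "\<forall>m\<in>{1..}. ?P m (s m)" ..
  then show thesis by (intro that[of s "W + weight_variation"]) auto
qed

end

section \<open>Bounds uniform in \<open>m\<close> and the conclusion\<close>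

lemma liminf_limsup_exp_bounds:
  fixes s :: "nat \<Rightarrow> real"
  assumes "0 < C" "\<And>m. 1 \<le> m \<Longrightarrow> \<bar>s m\<bar> \<le> B"
  shows "0 < liminf (\<lambda>m. ereal (C * exp (s m)))" "limsup (\<lambda>m. ereal (C * exp (s m))) < \<infinity>"
proof -
  \<comment> \<open>The value at \<open>m = 0\<close> is unconstrained, so the bounds
    \<open>C * exp (- B)\<close> and \<open>C * exp B\<close> are used only eventually.\<close>
  have ev: "\<forall>\<^sub>F m::nat in sequentially. 1 \<le> m" by (rule eventually_ge_at_top)
  have "\<forall>\<^sub>F m in sequentially. ereal (C * exp (- B)) \<le> ereal (C * exp (s m))"
    using ev
  proof eventually_elim
    case (elim m)
    then show ?case using assms(1) assms(2)[OF elim] by simp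
  qed
  then have "ereal (C * exp (- B)) \<le> liminf (\<lambda>m. ereal (C * exp (s m)))"
    by (rule Liminf_bounded)
  moreover have "0 < ereal (C * exp (- B))" using assms(1) by simp
  ultimately show "0 < liminf (\<lambda>m. ereal (C * exp (s m)))" by (rule less_le_trans[rotated])
  have "\<forall>\<^sub>F m in sequentially. ereal (C * exp (s m)) \<le> ereal (C * exp B)"
    using ev
  proof eventually_elim
    case (elim m)
    then show ?case using assms(1) assms(2)[OF elim] by simp
  qed
  then have "limsup (\<lambda>m. ereal (C * exp (s m))) \<le> ereal (C * exp B)"
    by (rule Limsup_bounded)
  then show "limsup (\<lambda>m. ereal (C * exp (s m))) < \<infinity>" by (rule le_less_trans) simp
qed

theorem theorem1:
  fixes a b d :: "nat \<Rightarrow> real" and \<sigma> :: real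
  assumes pos: "\<And>k. 1 \<le> k \<Longrightarrow> 0 < a k \<and> 0 < b k \<and> 0 < d k"
    and sigma: "0 < \<sigma>"
    and lower: "\<And>k. 1 \<le> k \<Longrightarrow> \<sigma> \<le> a k \<and> \<sigma> \<le> b k \<and> \<sigma> \<le> d k"
    and variation: "summable (\<lambda>k. \<bar>a (k + 2) - a (k + 1)\<bar> + \<bar>b (k + 2) - b (k + 1)\<bar>
                                 + \<bar>d (k + 2) - d (k + 1)\<bar>)"
    and cases_abc:
      "(\<exists>k0>0. (\<forall>k\<ge>k0. a k / b k = a (k+1) / b (k+1) \<and> d k / b k \<noteq> d (k+1) / b (k+1)) \<and>
          (\<exists>L::ereal. (\<lambda>k. ereal ((d k / b k - d (k+1) / b (k+1)) /
                                 (d (k+1) / b (k+1) - d (k+2) / b (k+2)))) \<longlonglongrightarrow> L))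
     \<or> (\<exists>k0>0. (\<forall>k\<ge>k0. a k / b k \<noteq> a (k+1) / b (k+1) \<and> d k / b k = d (k+1) / b (k+1)) \<and>
          (\<exists>L::ereal. (\<lambda>k. ereal ((a k / b k - a (k+1) / b (k+1)) /
                                 (a (k+1) / b (k+1) - a (k+2) / b (k+2)))) \<longlonglongrightarrow> L))
     \<or> (\<exists>k0>0. (\<forall>k\<ge>k0. a k / b k \<noteq> a (k+1) / b (k+1) \<and> d k / b k \<noteq> d (k+1) / b (k+1)) \<and>
          (\<exists>\<tau>::ereal.
             (\<lambda>k. ereal ((d k / b k - d (k+1) / b (k+1)) /
                         (a k / b k - a (k+1) / b (k+1)))) \<longlonglongrightarrow> \<tau> \<and>
             \<tau> \<noteq> ereal ((- lim a + sqrt ((lim a)\<^sup>2 + 4 * lim b * lim d)) / (2 * lim b)) \<and>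
             (\<bar>\<tau>\<bar> \<noteq> \<infinity> \<longrightarrow>
               (\<exists>L::ereal. (\<lambda>k. ereal ((a k / b k - a (k+1) / b (k+1)) /
                                      (a (k+1) / b (k+1) - a (k+2) / b (k+2)))) \<longlonglongrightarrow> L)) \<and>
             (\<bar>\<tau>\<bar> = \<infinity> \<longrightarrow>
               (\<exists>L::ereal. (\<lambda>k. ereal ((d k / b k - d (k+1) / b (k+1)) /
                                      (d (k+1) / b (k+1) - d (k+2) / b (k+2)))) \<longlonglongrightarrow> L))))"
  shows "\<forall>i\<in>{1,2}. \<forall>j\<in>{1,2}. \<exists>c :: nat \<Rightarrow> real.
      (\<forall>m\<ge>1. 0 < c m \<and>
         (\<lambda>k. backward_prod (step_mat a b d) m k $$ (i - 1, j - 1) /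
              (\<Prod>l = m..k. real_spectral_radius (step_mat a b d l))) \<longlonglongrightarrow> c m) \<and>
      0 < liminf (\<lambda>m. ereal (c m)) \<and>
      liminf (\<lambda>m. ereal (c m)) \<le> limsup (\<lambda>m. ereal (c m)) \<and>
      limsup (\<lambda>m. ereal (c m)) < \<infinity>"
proof (intro ballI)
  fix i j :: nat assume i: "i \<in> {1, 2}" and j: "j \<in> {1, 2}"
  interpret bounded_variation_steps a b d \<sigma>
    by unfold_locales (use sigma lower variation in auto)
  have "j - 1 < 2" using j by auto
  then obtain s B where B: "\<And>m. 1 \<le> m \<Longrightarrow> \<bar>s m\<bar> \<le> B"
    and lim0: "\<And>m. 1 \<le> m \<Longrightarrow> (\<lambda>k. backward_prod (step_mat a b d) m k $$ (0, j - 1) /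
        (\<Prod>l = m..k. perron_root l)) \<longlonglongrightarrow> exp (s m) / (2 - lim a / perron_root_lim)"
    and lim1: "\<And>m. 1 \<le> m \<Longrightarrow> (\<lambda>k. backward_prod (step_mat a b d) m k $$ (Suc 0, j - 1) /
        (\<Prod>l = m..k. perron_root l)) \<longlonglongrightarrow> lim d / perron_root_lim * (exp (s m) / (2 - lim a / perron_root_lim))"
    by (rule normalised_product_tendsto) blast
  \<comment> \<open>\<open>C\<close> collects everything in the limit that is independent of
    \<open>m\<close>. The second row carries the extra factor
    \<open>lim d / perron_root_lim\<close>, the limiting ratio of the two entries of a
    column.\<close>
  define C where "C = (if i = 1 then 1 else lim d / perron_root_lim) / (2 - lim a / perron_root_lim)"
  have "lim a / perron_root_lim < 1" using perron_root_lim_gt perron_root_lim_pos by simp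
  then have "0 < 2 - lim a / perron_root_lim" by linarith
  then have C: "0 < C"
    unfolding C_def using lim_abd perron_root_lim_pos by (intro divide_pos_pos) simp_all
  have "(\<Prod>l = m..k. real_spectral_radius (step_mat a b d l)) = (\<Prod>l = m..k. perron_root l)"
    if "1 \<le> m" for m k
    using that pos by (intro prod.cong) (auto simp: perron_root_def real_spectral_radius_step_mat)
  then have "(\<lambda>k. backward_prod (step_mat a b d) m k $$ (i - 1, j - 1) /
      (\<Prod>l = m..k. real_spectral_radius (step_mat a b d l))) \<longlonglongrightarrow> C * exp (s m)"
    if "1 \<le> m" for m
    using i lim0[OF that] lim1[OF that] that by (auto simp: C_def)
  then show "\<exists>c :: nat \<Rightarrow> real.
      (\<forall>m\<ge>1. 0 < c m \<and>
         (\<lambda>k. backward_prod (step_mat a b d) m k $$ (i - 1, j - 1) /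
              (\<Prod>l = m..k. real_spectral_radius (step_mat a b d l))) \<longlonglongrightarrow> c m) \<and>
      0 < liminf (\<lambda>m. ereal (c m)) \<and>
      liminf (\<lambda>m. ereal (c m)) \<le> limsup (\<lambda>m. ereal (c m)) \<and>
      limsup (\<lambda>m. ereal (c m)) < \<infinity>"
    using C liminf_limsup_exp_bounds[OF C B]
    by (intro exI[of _ "\<lambda>m. C * exp (s m)"]) (auto intro: Liminf_le_Limsup)
qed

end
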